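(* Suppose that $\mu\in\mathbb{R}$ and $\sigma>0$ are known parameters and $\alpha$ is unknown, and let $\Theta=\{\alpha\in\mathbb{R}:|\alpha|>0\}$ be the parameter space for $\alpha$. Let $X_1,X_2,\ldots$ be i.i.d. with distribution BN$(\mu,\sigma,\alpha)$, where $\alpha\in\Theta$ is the true parameter, let $\boldsymbol{X}=(X_1,\ldots,X_n)$, and let $\widehat\alpha=\widehat\alpha_n$ be a consistent solution of the log-likelihood equation $\partial l(\boldsymbol{\theta};\boldsymbol{X})/\partial\alpha=0$. Then $\sqrt n(\widehat\alpha-\alpha)$ converges in distribution to $N(0,1/\mathcal{I}(\alpha))$ as $n\to+\infty$.
   Context: BN$(\boldsymbol{\theta})$, $\boldsymbol{\theta}=(\mu,\sigma,\alpha)$ with $\mu\in\mathbb{R}$, $\sigma>0$, $\alpha\in\mathbb{R}$, is the distribution on $\mathbb{R}$ with PDF $$f(x;\boldsymbol{\theta})=\frac{1}{\sqrt{2\pi\sigma^2}}\exp\left[-\frac12\left(\frac{x-\mu}{\sigma}\right)^2-\frac{\alpha^2}{2}\right]\cosh\left[\alpha\left(\frac{x-\mu}{\sigma}\right)\right],\quad x\in\mathbb{R}.$$ The log-likelihood function is $l(\boldsymbol{\theta};\boldsymbol{X})=\sum_{i=1}^n\log f(X_i;\boldsymbol{\theta})$. A solution $\widehat\alpha_n$ of $\partial l(\boldsymbol{\theta};\boldsymbol{X})/\partial\alpha=0$ (existing with probability approaching $1$ as $n\to+\infty$) is consistent if it converges in probability to the true value $\alpha$. The Fisher information is $$\mathcal{I}(\alpha)=\mathbb{E}\left[\left(\frac{\partial\log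 f(X;\boldsymbol{\theta})}{\partial\alpha}\right)^2\right],\quad X\sim\text{BN}(\boldsymbol{\theta}),$$ which equals $1-e^{-\alpha^2/2}\,\mathbb{E}[Z^2\,\mathrm{sech}(\alpha Z)]$ for $Z\sim N(0,1)$, where $\mathrm{sech}=1/\cosh$. *)

theory Defs
  imports "HOL-Probability.Probability"
begin

definition bn_density :: "real \<Rightarrow> real \<Rightarrow> real \<Rightarrow> real \<Rightarrow> real" where
  "bn_density \<mu> \<sigma> \<alpha> x =
     1 / sqrt (2 * pi * \<sigma>\<^sup>2) * exp (- (1 / 2) * ((x - \<mu>) / \<sigma>)\<^sup>2 - \<alpha>\<^sup>2 / 2)
       * cosh (\<alpha> * ((x - \<mu>) / \<sigma>))"

definition BN :: "real \<Rightarrow> real \<Rightarrow> real \<Rightarrow> real measure" where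
  "BN \<mu> \<sigma> \<alpha> = density lborel (\<lambda>x. ennreal (bn_density \<mu> \<sigma> \<alpha> x))"

definition bn_alpha_space :: "real set" where
  "bn_alpha_space = {\<alpha>. \<bar>\<alpha>\<bar> > 0}"

text \<open>The sample \<open>X\<^sub>1, \<dots>, X\<^sub>n\<close> is indexed from zero, as \<open>x 0, \<dots>, x (n - 1)\<close>.\<close>

definition bn_loglik :: "real \<Rightarrow> real \<Rightarrow> real \<Rightarrow> nat \<Rightarrow> (nat \<Rightarrow> real) \<Rightarrow> real" where
  "bn_loglik \<mu> \<sigma> \<alpha> n x = (\<Sum>i<n. ln (bn_density \<mu> \<sigma> \<alpha> (x i)))"

definition bn_fisher_info :: "real \<Rightarrow> real \<Rightarrow> real \<Rightarrow> real" where
  "bn_fisher_info \<mu> \<sigma> \<alpha> =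
     (\<integral>x. (deriv (\<lambda>a. ln (bn_density \<mu> \<sigma> a x)) \<alpha>)\<^sup>2 \<partial>BN \<mu> \<sigma> \<alpha>)"

definition conv_in_prob :: "'a measure \<Rightarrow> (nat \<Rightarrow> 'a \<Rightarrow> real) \<Rightarrow> real \<Rightarrow> bool" where
  "conv_in_prob M Y c \<longleftrightarrow>
     (\<forall>\<epsilon>>0. (\<lambda>n. measure M {\<omega> \<in> space M. \<bar>Y n \<omega> - c\<bar> > \<epsilon>}) \<longlonglongrightarrow> 0)"

text \<open>
  A solution of the likelihood equation exists only with probability approaching one, so
  the estimator is a total random variable that solves the equation on an event whose
  probability tends to one; its values off that event are unconstrained.
\<close>

definition bn_consistent_solution ::
  "'a measure \<Rightarrow> (nat \<Rightarrow> 'a \<Rightarrow> real) \<Rightarrow> real \<Rightarrow> real \<Rightarrow> real \<Rightarrow> (nat \<Rightarrow> 'a \<Rightarrow> real) \<Rightarrow> bool" where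
  "bn_consistent_solution M X \<mu> \<sigma> \<alpha> A \<longleftrightarrow>
     (\<forall>n. A n \<in> borel_measurable M) \<and>
     (\<lambda>n. measure M {\<omega> \<in> space M.
        deriv (\<lambda>a. bn_loglik \<mu> \<sigma> a n (\<lambda>i. X i \<omega>)) (A n \<omega>) = 0}) \<longlonglongrightarrow> 1 \<and>
     conv_in_prob M A \<alpha>"

end

theory Submission
  imports Defs
begin

text \<open>
  With \<open>u = (x - \<mu>) / \<sigma>\<close> the score is \<open>u tanh (a u) - a\<close> and its derivative in \<open>a\<close> is
  \<open>u\<^sup>2 sech\<^sup>2 (a u) - 1\<close>. Since \<open>\<bar>y\<bar>\<^sup>3 sech\<^sup>2 y \<le> 1\<close>, the second derivative is bounded uniformly in
  the data for \<open>a\<close> near \<open>\<alpha> \<noteq> 0\<close>, so expanding the likelihood equation at \<open>\<alpha>\<close> leaves a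
  deterministic remainder \<open>O(n (a - \<alpha>)\<^sup>2)\<close>. The curvature \<open>u\<^sup>2 sech\<^sup>2 (\<alpha> u)\<close> is bounded, so its mean
  converges in probability by Hoeffding's inequality; the normalised score at \<open>\<alpha>\<close> is
  asymptotically normal by the central limit theorem. The moments come from writing BN as the
  equal mixture of \<open>N(\<mu> + \<sigma> \<alpha>, \<sigma>\<^sup>2)\<close> and \<open>N(\<mu> - \<sigma> \<alpha>, \<sigma>\<^sup>2)\<close>.
\<close>

section \<open>Elementary bounds for hyperbolic functions\<close>

lemma borel_measurable_tanh [measurable]: "(tanh :: real \<Rightarrow> real) \<in> borel_measurable borel"
  by (intro borel_measurable_continuous_onI continuous_intros) auto

lemma one_minus_tanh_square: "1 - (tanh x)\<^sup>2 = 1 / (cosh x)\<^sup>2" for x :: real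
proof -
  have "1 - (tanh x)\<^sup>2 = ((cosh x)\<^sup>2 - (sinh x)\<^sup>2) / (cosh x)\<^sup>2"
    by (simp add: tanh_def power_divide diff_divide_distrib)
  then show ?thesis
    by (simp only: hyperbolic_pythagoras)
qed

lemma tanh_square_le_1: "(tanh x)\<^sup>2 \<le> 1" for x :: real
  using tanh_real_bounds[of x] by (simp add: abs_square_le_1 abs_le_iff)

text \<open>The half-angle identity \<open>cosh x = 1 + 2 * (sinh (x / 2))\<^sup>2\<close> reduces
  this to \<open>y \<le> sinh y\<close> for \<open>y \<ge> 0\<close>, which follows because
  \<open>sinh y - y\<close> has derivative \<open>cosh y - 1 \<ge> 0\<close>.\<close>

lemma cosh_ge_quadratic: "1 + x\<^sup>2 / 2 \<le> cosh x" for x :: real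
proof -
  have "x / 2 \<le> sinh (x / 2)" if "0 \<le> x" for x :: real
  proof -
    have "(\<lambda>y. sinh y - y) 0 \<le> (\<lambda>y. sinh y - y) (x / 2)"
      by (rule DERIV_nonneg_imp_nondecreasing[where f = "\<lambda>y. sinh y - y"])
        (use that in \<open>auto intro!: exI derivative_eq_intros simp: cosh_real_ge_1\<close>)
    then show ?thesis by simp
  qed
  then have "(\<bar>x\<bar> / 2)\<^sup>2 \<le> (sinh (\<bar>x\<bar> / 2))\<^sup>2"
    by (intro power_mono) auto
  moreover have "cosh x = 1 + 2 * (sinh (\<bar>x\<bar> / 2))\<^sup>2"
    using cosh_double_cosh[of "\<bar>x\<bar> / 2"] by (simp add: cosh_square_eq)
  ultimately show ?thesis by (simp add: power_divide)
qed

text \<open>Expanding the square of \<open>\<bar>x\<bar>\<^sup>2 / 2 - \<bar>x\<bar>\<close>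
  isolates the cube as its cross term; what remains is dominated by the square of the quadratic
  lower bound for \<open>cosh\<close>.\<close>

lemma abs_cube_sech_square_le: "\<bar>x\<bar> ^ 3 * (1 - (tanh x)\<^sup>2) \<le> 1" for x :: real
proof -
  have "0 \<le> (\<bar>x\<bar> ^ 2 / 2 - \<bar>x\<bar>) ^ 2"
    by simp
  then have "\<bar>x\<bar> ^ 3 \<le> (1 + \<bar>x\<bar>\<^sup>2 / 2)\<^sup>2"
    by (simp add: power2_eq_square power3_eq_cube algebra_simps)
  also have "\<dots> \<le> (cosh x)\<^sup>2"
    using cosh_ge_quadratic[of x] by (intro power_mono) auto
  finally show ?thesis
    by (simp add: one_minus_tanh_square field_simps)
qed

text \<open>Taylor's theorem in the scale variable with Lagrange remainder. The second derivative
  carries a factor \<open>u ^ 3\<close>, but cubic decay of the squared sech bounds it by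
  \<open>2 / \<bar>t\<bar> ^ 3\<close> for every \<open>u\<close>; the closeness assumption keeps
  the intermediate point \<open>t\<close> away from zero.\<close>

lemma tanh_scale_taylor:
  fixes a \<alpha> u :: real
  assumes "\<alpha> \<noteq> 0" and close: "\<bar>a - \<alpha>\<bar> \<le> \<bar>\<alpha>\<bar> / 2"
  shows "\<bar>u * tanh (a * u) - u * tanh (\<alpha> * u) - (a - \<alpha>) * (u\<^sup>2 * (1 - (tanh (\<alpha> * u))\<^sup>2))\<bar>
    \<le> 8 / \<bar>\<alpha>\<bar> ^ 3 * (a - \<alpha>)\<^sup>2"
proof (cases "a = \<alpha>")
  case False
  \<comment> \<open>\<open>D m\<close> is the \<open>m\<close>-th derivative of
    \<open>t \<mapsto> u * tanh (t * u)\<close> for \<open>m \<le> 2\<close>; larger indices never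
    occur.\<close>
  define D where "D m t = (if m = 0 then u * tanh (t * u)
      else if m = 1 then u\<^sup>2 * (1 - (tanh (t * u))\<^sup>2)
      else - 2 * u ^ 3 * tanh (t * u) * (1 - (tanh (t * u))\<^sup>2))" for m :: nat and t
  have "\<exists>t. (if a < \<alpha> then a < t \<and> t < \<alpha> else \<alpha> < t \<and> t < a) \<and>
      D 0 a = (\<Sum>m<2. D m \<alpha> / fact m * (a - \<alpha>) ^ m) + D 2 t / fact 2 * (a - \<alpha>) ^ 2"
  proof (rule Taylor[of 2 D _ "min a \<alpha>" "max a \<alpha>"])
    show "\<forall>m t. m < 2 \<and> min a \<alpha> \<le> t \<and> t \<le> max a \<alpha> \<longrightarrow>
        (D m has_real_derivative D (Suc m) t) (at t)"
    proof (intro allI impI)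
      fix m :: nat and t :: real
      assume "m < 2 \<and> min a \<alpha> \<le> t \<and> t \<le> max a \<alpha>"
      then consider "m = 0" | "m = 1" by linarith
      then show "(D m has_real_derivative D (Suc m) t) (at t)"
        by cases (auto simp: D_def[abs_def] power2_eq_square power3_eq_cube algebra_simps
            intro!: derivative_eq_intros)
    qed
  qed (use False in auto)
  then obtain t where t: "if a < \<alpha> then a < t \<and> t < \<alpha> else \<alpha> < t \<and> t < a"
    and eq: "D 0 a = (\<Sum>m<2. D m \<alpha> / fact m * (a - \<alpha>) ^ m) + D 2 t / fact 2 * (a - \<alpha>) ^ 2"
    by blast
  have t_ge: "\<bar>\<alpha>\<bar> / 2 \<le> \<bar>t\<bar>"
    using t close \<open>\<alpha> \<noteq> 0\<close> by (auto split: if_splits)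
  \<comment> \<open>Multiplying by \<open>\<bar>t\<bar> ^ 3\<close> turns
    \<open>\<bar>u\<bar> ^ 3\<close> into the cube of the argument of \<open>tanh\<close>.\<close>
  have "\<bar>D 2 t\<bar> * \<bar>t\<bar> ^ 3 = 2 * \<bar>tanh (t * u)\<bar> * (\<bar>t * u\<bar> ^ 3 * (1 - (tanh (t * u))\<^sup>2))"
    using tanh_square_le_1[of "t * u"]
    by (simp add: D_def abs_mult power_abs power_mult_distrib)
  also have "\<dots> \<le> 2 * 1 * 1"
    using tanh_real_bounds[of "t * u"] tanh_square_le_1[of "t * u"]
    by (intro mult_mono abs_cube_sech_square_le) auto
  finally have "\<bar>D 2 t\<bar> * \<bar>t\<bar> ^ 3 \<le> 2" by simp
  moreover have "\<bar>D 2 t\<bar> * (\<bar>\<alpha>\<bar> / 2) ^ 3 \<le> \<bar>D 2 t\<bar> * \<bar>t\<bar> ^ 3"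
    using t_ge by (intro mult_left_mono power_mono) auto
  ultimately have "\<bar>D 2 t\<bar> * (\<bar>\<alpha>\<bar> / 2) ^ 3 \<le> 2" by linarith
  \<comment> \<open>Since \<open>2 / (\<bar>\<alpha>\<bar> / 2) ^ 3 = 16 / \<bar>\<alpha>\<bar> ^
    3\<close>, dividing by \<open>fact 2\<close> leaves the constant 8.\<close>
  then have D2: "\<bar>D 2 t\<bar> / 2 \<le> 8 / \<bar>\<alpha>\<bar> ^ 3"
    using \<open>\<alpha> \<noteq> 0\<close> by (simp add: power_divide field_simps)
  have remainder: "u * tanh (a * u) - u * tanh (\<alpha> * u) - (a - \<alpha>) * (u\<^sup>2 * (1 - (tanh (\<alpha> * u))\<^sup>2))
      = D 2 t / 2 * (a - \<alpha>)\<^sup>2"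
    using eq by (simp add: D_def numeral_2_eq_2 algebra_simps)
  show ?thesis unfolding remainder
    using mult_right_mono[OF D2, of "(a - \<alpha>)\<^sup>2"] by (simp add: abs_mult)
qed simp

section \<open>Score and curvature of the log-density\<close>

definition bn_score :: "real \<Rightarrow> real \<Rightarrow> real \<Rightarrow> real \<Rightarrow> real" where
  "bn_score \<mu> \<sigma> a x = (x - \<mu>) / \<sigma> * tanh (a * ((x - \<mu>) / \<sigma>)) - a"

text \<open>The curvature of the log-density in the parameter is \<open>bn_curv - 1\<close>.\<close>

definition bn_curv :: "real \<Rightarrow> real \<Rightarrow> real \<Rightarrow> real \<Rightarrow> real" where
  "bn_curv \<mu> \<sigma> a x = ((x - \<mu>) / \<sigma>)\<^sup>2 * (1 - (tanh (a * ((x - \<mu>) / \<sigma>)))\<^sup>2)"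

lemma borel_measurable_bn_score [measurable]: "bn_score \<mu> \<sigma> a \<in> borel_measurable borel"
  unfolding bn_score_def by measurable

lemma borel_measurable_bn_curv [measurable]: "bn_curv \<mu> \<sigma> a \<in> borel_measurable borel"
  unfolding bn_curv_def by measurable

text \<open>Boundedness of the curvature is what allows Hoeffding's inequality. Rescaling to
  \<open>y = \<alpha> * u\<close> reduces it to
  \<open>y\<^sup>2 \<le> (cosh y)\<^sup>2\<close>.\<close>

lemma bn_curv_bounds:
  assumes "\<alpha> \<noteq> 0"
  shows "0 \<le> bn_curv \<mu> \<sigma> \<alpha> x" "bn_curv \<mu> \<sigma> \<alpha> x \<le> 1 / \<alpha>\<^sup>2"
proof -
  define y where "y = \<alpha> * ((x - \<mu>) / \<sigma>)"
  have "y\<^sup>2 \<le> (1 + y\<^sup>2 / 2)\<^sup>2"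
    by (simp add: power2_sum)
  also have "\<dots> \<le> (cosh y)\<^sup>2"
    using cosh_ge_quadratic[of y] by (intro power_mono) auto
  finally have "y\<^sup>2 * (1 - (tanh y)\<^sup>2) \<le> 1"
    by (simp add: one_minus_tanh_square)
  moreover have "bn_curv \<mu> \<sigma> \<alpha> x = y\<^sup>2 * (1 - (tanh y)\<^sup>2) / \<alpha>\<^sup>2"
    unfolding bn_curv_def y_def[symmetric] using assms by (simp add: y_def power_mult_distrib power_divide)
  ultimately show "bn_curv \<mu> \<sigma> \<alpha> x \<le> 1 / \<alpha>\<^sup>2"
    by (simp add: divide_right_mono)
  show "0 \<le> bn_curv \<mu> \<sigma> \<alpha> x"
    using tanh_square_le_1 by (auto simp: bn_curv_def)
qed

lemma bn_density_pos: "\<sigma> > 0 \<Longrightarrow> bn_density \<mu> \<sigma> a x > 0"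
  by (simp add: bn_density_def)

lemma borel_measurable_bn_density [measurable]: "bn_density \<mu> \<sigma> a \<in> borel_measurable borel"
  unfolding bn_density_def cosh_field_def by measurable

lemma DERIV_ln_bn_density:
  assumes "\<sigma> > 0"
  shows "((\<lambda>a. ln (bn_density \<mu> \<sigma> a x)) has_real_derivative bn_score \<mu> \<sigma> a x) (at a)"
proof -
  define u where "u = (x - \<mu>) / \<sigma>"
  have eq: "ln (bn_density \<mu> \<sigma> a x)
      = ln (1 / sqrt (2 * pi * \<sigma>\<^sup>2)) + (- (1 / 2) * u\<^sup>2 - a\<^sup>2 / 2) + ln (cosh (a * u))" for a
    using assms unfolding bn_density_def u_def[symmetric]
    by (subst ln_mult ln_mult_pos, (simp; fail), (simp; fail)?)+ simp
  have score: "bn_score \<mu> \<sigma> a x = u * tanh (a * u) - a"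
    by (simp add: bn_score_def u_def)
  show ?thesis unfolding eq score
    by (auto intro!: derivative_eq_intros simp: tanh_def)
qed

lemma deriv_bn_loglik:
  assumes "\<sigma> > 0"
  shows "deriv (\<lambda>a. bn_loglik \<mu> \<sigma> a n x) a = (\<Sum>i<n. bn_score \<mu> \<sigma> a (x i))"
  unfolding bn_loglik_def
  by (intro DERIV_imp_deriv DERIV_sum DERIV_ln_bn_density assms)

lemma bn_fisher_info_eq:
  assumes "\<sigma> > 0"
  shows "bn_fisher_info \<mu> \<sigma> \<alpha> = (\<integral>x. (bn_score \<mu> \<sigma> \<alpha> x)\<^sup>2 \<partial>BN \<mu> \<sigma> \<alpha>)"
  unfolding bn_fisher_info_def DERIV_imp_deriv[OF DERIV_ln_bn_density[OF assms]] ..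

section \<open>Moments through the mixture of two normal laws\<close>

lemma bn_density_mixture:
  assumes "\<sigma> > 0"
  shows "bn_density \<mu> \<sigma> \<alpha> x
      = (normal_density (\<mu> + \<sigma> * \<alpha>) \<sigma> x + normal_density (\<mu> - \<sigma> * \<alpha>) \<sigma> x) / 2"
    and "bn_density \<mu> \<sigma> \<alpha> x * tanh (\<alpha> * ((x - \<mu>) / \<sigma>))
      = (normal_density (\<mu> + \<sigma> * \<alpha>) \<sigma> x - normal_density (\<mu> - \<sigma> * \<alpha>) \<sigma> x) / 2"
proof -
  define u where "u = (x - \<mu>) / \<sigma>"
  define K where "K = 1 / sqrt (2 * pi * \<sigma>\<^sup>2) * exp (- (1 / 2) * u\<^sup>2 - \<alpha>\<^sup>2 / 2)"
  have x: "x = \<mu> + \<sigma> * u"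
    using assms by (simp add: u_def)
  \<comment> \<open>Completing the square: for \<open>b = \<alpha>\<close> and
    \<open>b = - \<alpha>\<close> the normalising factor \<open>exp (- b\<^sup>2 / 2)\<close> is the
    same, so only \<open>exp (b * u)\<close> differs. The half-sum of the two exponentials is
    \<open>cosh\<close>, the half-difference \<open>sinh\<close>.\<close>
  have shift: "normal_density (\<mu> + \<sigma> * b) \<sigma> x = K * exp (b * u)" if "b\<^sup>2 = \<alpha>\<^sup>2" for b
  proof -
    have "- ((x - (\<mu> + \<sigma> * b))\<^sup>2 / (2 * \<sigma>\<^sup>2)) = - (1 / 2) * u\<^sup>2 - b\<^sup>2 / 2 + b * u"
      unfolding x using assms by (simp add: power2_eq_square field_simps)
    then show ?thesis
      using that by (simp add: normal_density_def K_def exp_add)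
  qed
  have dens: "bn_density \<mu> \<sigma> \<alpha> x = K * cosh (\<alpha> * u)"
    by (simp add: bn_density_def K_def u_def)
  have 1: "normal_density (\<mu> + \<sigma> * \<alpha>) \<sigma> x = K * exp (\<alpha> * u)"
    by (rule shift) simp
  have 2: "normal_density (\<mu> - \<sigma> * \<alpha>) \<sigma> x = K * exp (- (\<alpha> * u))"
    using shift[of "- \<alpha>"] by simp
  show "bn_density \<mu> \<sigma> \<alpha> x
      = (normal_density (\<mu> + \<sigma> * \<alpha>) \<sigma> x + normal_density (\<mu> - \<sigma> * \<alpha>) \<sigma> x) / 2"
    unfolding 1 2 dens by (simp add: cosh_field_def algebra_simps)
  have "bn_density \<mu> \<sigma> \<alpha> x * tanh (\<alpha> * u) = K * sinh (\<alpha> * u)"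
    by (simp add: dens tanh_def)
  then show "bn_density \<mu> \<sigma> \<alpha> x * tanh (\<alpha> * ((x - \<mu>) / \<sigma>))
      = (normal_density (\<mu> + \<sigma> * \<alpha>) \<sigma> x - normal_density (\<mu> - \<sigma> * \<alpha>) \<sigma> x) / 2"
    unfolding 1 2 u_def[symmetric] by (simp add: sinh_field_def algebra_simps)
qed

text \<open>Standardising by \<open>\<mu>\<close> instead of the mean turns the law into N(b, 1).
  The moments follow from the central ones by splitting \<open>x - \<mu>\<close> into
  \<open>x - (\<mu> + \<sigma> * b)\<close> and \<open>\<sigma> * b\<close>.\<close>

lemma normal_standardized_moments:
  assumes "\<sigma> > 0"
  shows "has_bochner_integral lborel (normal_density (\<mu> + \<sigma> * b) \<sigma>) 1"
    and "has_bochner_integral lborel (\<lambda>x. normal_density (\<mu> + \<sigma> * b) \<sigma> x * ((x - \<mu>) / \<sigma>)) b"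
    and "has_bochner_integral lborel (\<lambda>x. normal_density (\<mu> + \<sigma> * b) \<sigma> x * ((x - \<mu>) / \<sigma>)\<^sup>2) (1 + b\<^sup>2)"
proof -
  let ?m = "\<mu> + \<sigma> * b"
  let ?f = "normal_density ?m \<sigma>"
  have 0: "has_bochner_integral lborel ?f 1"
    using normal_moment_even[OF assms, of ?m 0] by simp
  have 1: "has_bochner_integral lborel (\<lambda>x. ?f x * (x - ?m)) 0"
    using normal_moment_odd[OF assms, of ?m 0] by simp
  have 2: "has_bochner_integral lborel (\<lambda>x. ?f x * (x - ?m)\<^sup>2) (\<sigma>\<^sup>2)"
    using normal_moment_even[OF assms, of ?m 1] by simp
  show "has_bochner_integral lborel ?f 1" by fact
  have "has_bochner_integral lborel (\<lambda>x. ?f x * (x - ?m) / \<sigma> + ?f x * b) (0 / \<sigma> + 1 * b)"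
    by (intro has_bochner_integral_add has_bochner_integral_divide
        has_bochner_integral_mult_left 0 1)
  also have "(\<lambda>x. ?f x * (x - ?m) / \<sigma> + ?f x * b) = (\<lambda>x. ?f x * ((x - \<mu>) / \<sigma>))"
    using assms by (intro ext) (simp add: field_simps)
  finally show "has_bochner_integral lborel (\<lambda>x. ?f x * ((x - \<mu>) / \<sigma>)) b" by simp
  have "has_bochner_integral lborel
      (\<lambda>x. ?f x * (x - ?m)\<^sup>2 / \<sigma>\<^sup>2 + ?f x * (x - ?m) * (2 * b / \<sigma>) + ?f x * b\<^sup>2)
      (\<sigma>\<^sup>2 / \<sigma>\<^sup>2 + 0 * (2 * b / \<sigma>) + 1 * b\<^sup>2)"
    by (intro has_bochner_integral_add has_bochner_integral_divide
        has_bochner_integral_mult_left 0 1 2)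
  also have "(\<lambda>x. ?f x * (x - ?m)\<^sup>2 / \<sigma>\<^sup>2 + ?f x * (x - ?m) * (2 * b / \<sigma>) + ?f x * b\<^sup>2)
      = (\<lambda>x. ?f x * ((x - \<mu>) / \<sigma>)\<^sup>2)"
    using assms by (intro ext) (simp add: power2_eq_square field_simps)
  finally show "has_bochner_integral lborel (\<lambda>x. ?f x * ((x - \<mu>) / \<sigma>)\<^sup>2) (1 + b\<^sup>2)"
    using assms by simp
qed

text \<open>Averaging over the two components gives the even moments. The weight \<open>tanh\<close>
  replaces the sum of the components by their difference, so the opposite means
  \<open>\<alpha>\<close> and \<open>- \<alpha>\<close> reinforce each other instead of
  cancelling.\<close>

lemma BN_moments:
  assumes "\<sigma> > 0"
  shows "has_bochner_integral (BN \<mu> \<sigma> \<alpha>) (\<lambda>_. 1 :: real) 1"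
    and "has_bochner_integral (BN \<mu> \<sigma> \<alpha>)
      (\<lambda>x. (x - \<mu>) / \<sigma> * tanh (\<alpha> * ((x - \<mu>) / \<sigma>))) \<alpha>"
    and "has_bochner_integral (BN \<mu> \<sigma> \<alpha>) (\<lambda>x. ((x - \<mu>) / \<sigma>)\<^sup>2) (1 + \<alpha>\<^sup>2)"
proof -
  let ?p = "normal_density (\<mu> + \<sigma> * \<alpha>) \<sigma>" and ?q = "normal_density (\<mu> + \<sigma> * (- \<alpha>)) \<sigma>"
  let ?u = "\<lambda>x. (x - \<mu>) / \<sigma>"
  note p = normal_standardized_moments[OF assms, of \<mu> \<alpha>]
  note q = normal_standardized_moments[OF assms, of \<mu> "- \<alpha>"]
  have density: "has_bochner_integral (BN \<mu> \<sigma> \<alpha>) f c"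
    if "has_bochner_integral lborel (\<lambda>x. bn_density \<mu> \<sigma> \<alpha> x * f x) c"
      "f \<in> borel_measurable borel" for f :: "real \<Rightarrow> real" and c
    unfolding BN_def using that bn_density_pos[OF assms]
    by (intro has_bochner_integral_density) (auto simp: less_imp_le)
  have "has_bochner_integral lborel (\<lambda>x. (?p x + ?q x) / 2) ((1 + 1) / 2)"
    by (intro has_bochner_integral_divide has_bochner_integral_add p q)
  then show "has_bochner_integral (BN \<mu> \<sigma> \<alpha>) (\<lambda>_. 1 :: real) 1"
    by (intro density) (simp_all add: bn_density_mixture(1)[OF assms])
  have "has_bochner_integral lborel (\<lambda>x. (?p x * ?u x - ?q x * ?u x) / 2) ((\<alpha> - (- \<alpha>)) / 2)"
    by (intro has_bochner_integral_divide has_bochner_integral_diff p q)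
  also have "(\<lambda>x. (?p x * ?u x - ?q x * ?u x) / 2)
      = (\<lambda>x. bn_density \<mu> \<sigma> \<alpha> x * (?u x * tanh (\<alpha> * ?u x)))"
  proof
    fix x
    have "(?p x * ?u x - ?q x * ?u x) / 2 = (?p x - ?q x) / 2 * ?u x"
      by (simp only: left_diff_distrib times_divide_eq_left)
    also have "\<dots> = bn_density \<mu> \<sigma> \<alpha> x * tanh (\<alpha> * ?u x) * ?u x"
      unfolding bn_density_mixture(2)[OF assms, of \<mu> \<alpha> x] by simp
    finally show "(?p x * ?u x - ?q x * ?u x) / 2
        = bn_density \<mu> \<sigma> \<alpha> x * (?u x * tanh (\<alpha> * ?u x))"
      by (simp only: mult_ac)
  qed
  finally show "has_bochner_integral (BN \<mu> \<sigma> \<alpha>) (\<lambda>x. ?u x * tanh (\<alpha> * ?u x)) \<alpha>"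
    by (intro density) simp_all
  have "has_bochner_integral lborel (\<lambda>x. (?p x * (?u x)\<^sup>2 + ?q x * (?u x)\<^sup>2) / 2)
      ((1 + \<alpha>\<^sup>2 + (1 + (- \<alpha>)\<^sup>2)) / 2)"
    by (intro has_bochner_integral_divide has_bochner_integral_add p q)
  also have "(\<lambda>x. (?p x * (?u x)\<^sup>2 + ?q x * (?u x)\<^sup>2) / 2)
      = (\<lambda>x. bn_density \<mu> \<sigma> \<alpha> x * (?u x)\<^sup>2)"
    by (rule ext, unfold bn_density_mixture(1)[OF assms]) (simp add: ring_distribs add_divide_distrib)
  finally show "has_bochner_integral (BN \<mu> \<sigma> \<alpha>) (\<lambda>x. (?u x)\<^sup>2) (1 + \<alpha>\<^sup>2)"
    by (intro density) (simp_all add: add_divide_distrib)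
qed

section \<open>Moments of the score and the Fisher information\<close>

lemma sets_BN [measurable_cong, simp]: "sets (BN \<mu> \<sigma> \<alpha>) = sets borel"
  by (simp add: BN_def)

lemma has_bochner_integral_bn_score:
  assumes "\<sigma> > 0"
  shows "has_bochner_integral (BN \<mu> \<sigma> \<alpha>) (bn_score \<mu> \<sigma> \<alpha>) 0"
  using has_bochner_integral_diff[OF BN_moments(2)[OF assms, of \<mu> \<alpha>]
      has_bochner_integral_mult_left[of \<alpha>, OF BN_moments(1)[OF assms, of \<mu> \<alpha>]]]
  by (simp add: bn_score_def[abs_def])

text \<open>The information identity, obtained without differentiating under the integral: since
  \<open>u\<^sup>2 * (tanh (\<alpha> * u))\<^sup>2 = u\<^sup>2 - bn_curv\<close>, the squared score
  is a linear combination of the curvature and functions with known means.\<close>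

lemma bn_score_curv_integrals:
  assumes "\<sigma> > 0"
  shows "integrable (BN \<mu> \<sigma> \<alpha>) (\<lambda>x. (bn_score \<mu> \<sigma> \<alpha> x)\<^sup>2)"
    and "(\<integral>x. bn_curv \<mu> \<sigma> \<alpha> x \<partial>BN \<mu> \<sigma> \<alpha>) = 1 - bn_fisher_info \<mu> \<sigma> \<alpha>"
proof -
  let ?N = "BN \<mu> \<sigma> \<alpha>" and ?u = "\<lambda>x. (x - \<mu>) / \<sigma>"
  note moments = BN_moments[OF assms, of \<mu> \<alpha>]
  have "integrable ?N (bn_curv \<mu> \<sigma> \<alpha>)"
  proof (rule Bochner_Integration.integrable_bound)
    show "integrable ?N (\<lambda>x. (?u x)\<^sup>2)"
      using moments(3) by (rule integrable.intros)
    show "AE x in ?N. norm (bn_curv \<mu> \<sigma> \<alpha> x) \<le> norm ((?u x)\<^sup>2)"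
      using tanh_square_le_1
      by (intro AE_I2) (auto simp: bn_curv_def abs_mult intro!: mult_left_le)
  qed measurable
  then have curv: "has_bochner_integral ?N (bn_curv \<mu> \<sigma> \<alpha>) (\<integral>x. bn_curv \<mu> \<sigma> \<alpha> x \<partial>?N)"
    by (rule has_bochner_integral_integrable)
  have "has_bochner_integral ?N
      (\<lambda>x. (?u x)\<^sup>2 - bn_curv \<mu> \<sigma> \<alpha> x - ?u x * tanh (\<alpha> * ?u x) * (2 * \<alpha>) + 1 * \<alpha>\<^sup>2)
      (1 + \<alpha>\<^sup>2 - (\<integral>x. bn_curv \<mu> \<sigma> \<alpha> x \<partial>?N) - \<alpha> * (2 * \<alpha>) + 1 * \<alpha>\<^sup>2)"
    by (intro has_bochner_integral_add has_bochner_integral_diff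
        has_bochner_integral_mult_left moments curv)
  also have "(\<lambda>x. (?u x)\<^sup>2 - bn_curv \<mu> \<sigma> \<alpha> x - ?u x * tanh (\<alpha> * ?u x) * (2 * \<alpha>) + 1 * \<alpha>\<^sup>2)
      = (\<lambda>x. (bn_score \<mu> \<sigma> \<alpha> x)\<^sup>2)"
  proof
    fix x
    define u where "u = ?u x"
    show "(?u x)\<^sup>2 - bn_curv \<mu> \<sigma> \<alpha> x - ?u x * tanh (\<alpha> * ?u x) * (2 * \<alpha>) + 1 * \<alpha>\<^sup>2
        = (bn_score \<mu> \<sigma> \<alpha> x)\<^sup>2"
      unfolding bn_curv_def bn_score_def u_def[symmetric]
      by (simp add: power2_eq_square algebra_simps)
  qed
  also have "1 + \<alpha>\<^sup>2 - (\<integral>x. bn_curv \<mu> \<sigma> \<alpha> x \<partial>?N) - \<alpha> * (2 * \<alpha>) + 1 * \<alpha>\<^sup>2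
      = 1 - (\<integral>x. bn_curv \<mu> \<sigma> \<alpha> x \<partial>?N)"
    by (simp add: power2_eq_square)
  finally have *: "has_bochner_integral ?N (\<lambda>x. (bn_score \<mu> \<sigma> \<alpha> x)\<^sup>2)
      (1 - (\<integral>x. bn_curv \<mu> \<sigma> \<alpha> x \<partial>?N))" .
  show "integrable ?N (\<lambda>x. (bn_score \<mu> \<sigma> \<alpha> x)\<^sup>2)"
    using * by (rule integrable.intros)
  show "(\<integral>x. bn_curv \<mu> \<sigma> \<alpha> x \<partial>?N) = 1 - bn_fisher_info \<mu> \<sigma> \<alpha>"
    using has_bochner_integral_integral_eq[OF *] bn_fisher_info_eq[OF assms, of \<mu> \<alpha>] by simp
qed

text \<open>Zero information would make the score vanish almost everywhere. But the score equation
  forces \<open>\<bar>\<alpha>\<bar> \<le> \<bar>u\<bar>\<close>, which fails on a whole interval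
  around \<open>\<mu>\<close>.\<close>

lemma bn_fisher_info_pos:
  assumes "\<sigma> > 0" "\<alpha> \<noteq> 0"
  shows "bn_fisher_info \<mu> \<sigma> \<alpha> > 0"
proof (rule ccontr)
  assume "\<not> bn_fisher_info \<mu> \<sigma> \<alpha> > 0"
  moreover have "bn_fisher_info \<mu> \<sigma> \<alpha> \<ge> 0"
    unfolding bn_fisher_info_eq[OF assms(1)] by (rule integral_nonneg_AE) simp
  ultimately have "(\<integral>x. (bn_score \<mu> \<sigma> \<alpha> x)\<^sup>2 \<partial>BN \<mu> \<sigma> \<alpha>) = 0"
    using bn_fisher_info_eq[OF assms(1), of \<mu> \<alpha>] by linarith
  then have "AE x in BN \<mu> \<sigma> \<alpha>. (bn_score \<mu> \<sigma> \<alpha> x)\<^sup>2 = 0"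
    using bn_score_curv_integrals(1)[OF assms(1)]
    by (subst (asm) integral_nonneg_eq_0_iff_AE) auto
  \<comment> \<open>The density is strictly positive, so null sets for BN are Lebesgue null.\<close>
  then have "AE x in lborel. bn_score \<mu> \<sigma> \<alpha> x = 0"
    unfolding BN_def using bn_density_pos[OF assms(1), of \<mu> \<alpha>]
    by (subst (asm) AE_density) auto
  moreover have "bn_score \<mu> \<sigma> \<alpha> x \<noteq> 0" if x: "x \<in> {\<mu> - \<sigma> * \<bar>\<alpha>\<bar><..<\<mu> + \<sigma> * \<bar>\<alpha>\<bar>}" for x
  proof
    define u where "u = (x - \<mu>) / \<sigma>"
    assume "bn_score \<mu> \<sigma> \<alpha> x = 0"
    then have "u * tanh (\<alpha> * u) = \<alpha>"
      by (simp add: bn_score_def u_def)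
    then have "\<bar>\<alpha>\<bar> = \<bar>u\<bar> * \<bar>tanh (\<alpha> * u)\<bar>"
      by (simp flip: abs_mult)
    also have "\<dots> \<le> \<bar>u\<bar>"
      using tanh_real_bounds[of "\<alpha> * u"] by (intro mult_left_le) auto
    also have "\<bar>u\<bar> < \<bar>\<alpha>\<bar>"
      using x assms by (auto simp: u_def abs_less_iff field_simps)
    finally show False by simp
  qed
  ultimately have "AE x in lborel. x \<notin> {\<mu> - \<sigma> * \<bar>\<alpha>\<bar><..<\<mu> + \<sigma> * \<bar>\<alpha>\<bar>}"
    by (auto elim!: eventually_mono)
  then have "emeasure lborel {\<mu> - \<sigma> * \<bar>\<alpha>\<bar><..<\<mu> + \<sigma> * \<bar>\<alpha>\<bar>} = 0"
    by (subst (asm) AE_iff_measurable[where N = "{\<mu> - \<sigma> * \<bar>\<alpha>\<bar><..<\<mu> + \<sigma> * \<bar>\<alpha>\<bar>}"]) auto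
  moreover have "\<mu> - \<sigma> * \<bar>\<alpha>\<bar> \<le> \<mu> + \<sigma> * \<bar>\<alpha>\<bar>"
    using assms by simp
  ultimately show False
    using assms by (auto simp: ennreal_eq_0_iff mult_le_0_iff)
qed

section \<open>The likelihood equation near the true parameter\<close>

lemma bn_score_expansion:
  assumes "\<alpha> \<noteq> 0" and "\<bar>a - \<alpha>\<bar> \<le> \<bar>\<alpha>\<bar> / 2"
    and root: "(\<Sum>i<n. bn_score \<mu> \<sigma> a (x i)) = 0"
  shows "\<bar>(\<Sum>i<n. bn_score \<mu> \<sigma> \<alpha> (x i)) - (a - \<alpha>) * (\<Sum>i<n. 1 - bn_curv \<mu> \<sigma> \<alpha> (x i))\<bar>
    \<le> real n * (8 / \<bar>\<alpha>\<bar> ^ 3 * (a - \<alpha>)\<^sup>2)"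
proof -
  let ?r = "\<lambda>y. bn_score \<mu> \<sigma> a y - bn_score \<mu> \<sigma> \<alpha> y + (a - \<alpha>) * (1 - bn_curv \<mu> \<sigma> \<alpha> y)"
  have r: "\<bar>?r y\<bar> \<le> 8 / \<bar>\<alpha>\<bar> ^ 3 * (a - \<alpha>)\<^sup>2" for y
  proof -
    define u where "u = (y - \<mu>) / \<sigma>"
    \<comment> \<open>The terms \<open>- a\<close> and \<open>\<alpha>\<close> of the two scores
      cancel the constant 1 in \<open>1 - bn_curv\<close>, leaving exactly the Taylor
      remainder.\<close>
    have "?r y = u * tanh (a * u) - u * tanh (\<alpha> * u)
        - (a - \<alpha>) * (u\<^sup>2 * (1 - (tanh (\<alpha> * u))\<^sup>2))"
      unfolding bn_score_def bn_curv_def u_def[symmetric] by (simp add: algebra_simps)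
    then show ?thesis
      using tanh_scale_taylor[OF assms(1,2), of u] by simp
  qed
  have "\<bar>\<Sum>i<n. ?r (x i)\<bar> \<le> (\<Sum>i<n. \<bar>?r (x i)\<bar>)"
    by (rule sum_abs)
  also have "\<dots> \<le> (\<Sum>i<n. 8 / \<bar>\<alpha>\<bar> ^ 3 * (a - \<alpha>)\<^sup>2)"
    by (intro sum_mono r)
  also have "(\<Sum>i<n. ?r (x i)) = - ((\<Sum>i<n. bn_score \<mu> \<sigma> \<alpha> (x i))
      - (a - \<alpha>) * (\<Sum>i<n. 1 - bn_curv \<mu> \<sigma> \<alpha> (x i)))"
    using root by (simp add: sum.distrib sum_subtractf flip: sum_distrib_left)
  finally show ?thesis
    by simp
qed

section \<open>Weak law of large numbers for bounded variables\<close>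

lemma (in prob_space) weak_law_bounded:
  fixes Z :: "nat \<Rightarrow> 'a \<Rightarrow> real"
  assumes indep: "indep_vars (\<lambda>_. borel) Z UNIV"
    and distr: "\<And>i. distr M borel (Z i) = D"
    and bounds: "\<And>\<omega>. \<omega> \<in> space M \<Longrightarrow> Z 0 \<omega> \<in> {a..b}"
    and "a < b" "\<epsilon> > 0"
  shows "(\<lambda>n. prob {\<omega> \<in> space M. \<bar>(\<Sum>i<n. Z i \<omega>) / real n - expectation (Z 0)\<bar> \<ge> \<epsilon>}) \<longlonglongrightarrow> 0"
proof -
  have [measurable]: "Z i \<in> borel_measurable M" for i
    using indep unfolding indep_vars_def2 by simp
  \<comment> \<open>The Hoeffding tail is geometric in \<open>n\<close> with this ratio.\<close>
  define q where "q = exp (- (2 * \<epsilon>\<^sup>2 / (b - a)\<^sup>2))"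
  have q: "0 \<le> q" "q < 1"
    using assms by (auto simp: q_def)
  \<comment> \<open>Hoeffding's inequality is applied to a nonempty index set, so
    \<open>n = 0\<close> is excluded; the limit only needs the bound eventually.\<close>
  have bound: "prob {\<omega> \<in> space M. \<bar>(\<Sum>i<n. Z i \<omega>) / real n - expectation (Z 0)\<bar> \<ge> \<epsilon>} \<le> 2 * q ^ n"
    if "n > 0" for n
  proof -
    interpret Hoeffding_ineq_iid M "{..<n}" Z "Z 0" a b "expectation (Z 0)"
    proof (unfold_locales, goal_cases)
      case 2
      show ?case by (rule indep_vars_subset[OF indep]) simp
    next
      case (3 i)
      show ?case by (simp only: distr)
    next
      case 5
      show ?case by (rule AE_I2) (rule bounds)
    qed simp_all
    have "prob {\<omega> \<in> space M. \<bar>(\<Sum>i<n. Z i \<omega>) / real n - expectation (Z 0)\<bar> \<ge> \<epsilon>}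
        \<le> 2 * exp (- 2 * real n * \<epsilon>\<^sup>2 / (b - a)\<^sup>2)"
    proof (rule Hoeffding_ineq_abs_ge'[unfolded card_lessThan])
      show "{..<n} \<noteq> {}"
        using that by (auto simp: lessThan_empty_iff)
    qed (use \<open>a < b\<close> \<open>\<epsilon> > 0\<close> in simp_all)
    also have "exp (- 2 * real n * \<epsilon>\<^sup>2 / (b - a)\<^sup>2) = q ^ n"
      by (simp add: q_def mult_ac flip: exp_of_nat_mult)
    finally show ?thesis .
  qed
  have "(\<lambda>n. 2 * q ^ n) \<longlonglongrightarrow> 2 * 0"
    by (intro tendsto_mult tendsto_const LIMSEQ_realpow_zero q)
  then have lim: "(\<lambda>n. 2 * q ^ n) \<longlonglongrightarrow> 0"
    by simp
  show ?thesis
  proof (rule tendsto_sandwich[OF _ _ tendsto_const lim])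
    show "\<forall>\<^sub>F n in sequentially.
        prob {\<omega> \<in> space M. \<bar>(\<Sum>i<n. Z i \<omega>) / real n - expectation (Z 0)\<bar> \<ge> \<epsilon>} \<le> 2 * q ^ n"
      using eventually_gt_at_top[of 0] by (rule eventually_mono) (rule bound)
  qed (intro always_eventually allI measure_nonneg)
qed

section \<open>Slutsky's theorem in terms of distribution functions\<close>

lemma (in prob_space) cdf_distr:
  "f \<in> borel_measurable M \<Longrightarrow> cdf (distr M borel f) t = prob {\<omega> \<in> space M. f \<omega> \<le> t}"
  by (auto simp: cdf_def measure_distr intro!: arg_cong[where f = prob])

text \<open>
  A form of Slutsky's theorem: \<open>T n\<close> is, up to a vanishing relative error, \<open>W n / c\<close>. An
  error relative to \<open>T n\<close> can be absorbed into a shift of the threshold \<open>t\<close>, so no tightness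
  argument is needed.
\<close>

lemma (in prob_space) cdf_tendsto_of_relative_error:
  fixes W T :: "nat \<Rightarrow> 'a \<Rightarrow> real"
  assumes [measurable]: "\<And>n. W n \<in> borel_measurable M" "\<And>n. T n \<in> borel_measurable M"
    and W: "weak_conv_m (\<lambda>n. distr M borel (W n)) \<nu>"
    and cont: "\<And>x. isCont (cdf \<nu>) x"
    and "c > 0"
    and bad: "\<And>\<eta>. \<eta> > 0 \<Longrightarrow>
      (\<lambda>n. prob {\<omega> \<in> space M. \<not> \<bar>W n \<omega> - c * T n \<omega>\<bar> \<le> \<eta> * \<bar>T n \<omega>\<bar>}) \<longlonglongrightarrow> 0"
  shows "(\<lambda>n. cdf (distr M borel (T n)) t) \<longlonglongrightarrow> cdf \<nu> (c * t)"
proof (rule tendstoI)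
  fix e :: real
  assume "e > 0"
  then have "\<exists>d>0. \<forall>x. \<bar>x - c * t\<bar> < d \<longrightarrow> \<bar>cdf \<nu> x - cdf \<nu> (c * t)\<bar> < e / 3"
    using cont[of "c * t"] unfolding continuous_at_eps_delta dist_real_def
    by (elim allE[of _ "e / 3"]) simp
  then obtain d where d: "d > 0"
    "\<And>x. \<bar>x - c * t\<bar> < d \<Longrightarrow> \<bar>cdf \<nu> x - cdf \<nu> (c * t)\<bar> < e / 3"
    by blast
  \<comment> \<open>The first bound keeps both slopes \<open>c - \<eta>\<close> and
    \<open>c + \<eta>\<close> positive; the second keeps the shifted thresholds within
    \<open>d\<close> of \<open>c * t\<close>. Adding 1 covers \<open>t = 0\<close>.\<close>
  define \<eta> where "\<eta> = min (c / 2) (d / (\<bar>t\<bar> + 1))"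
  have \<eta>: "\<eta> > 0" "\<eta> < c"
    using \<open>c > 0\<close> \<open>d > 0\<close> by (auto simp: \<eta>_def min_less_iff_disj)
  have "\<eta> * \<bar>t\<bar> < \<eta> * (\<bar>t\<bar> + 1)"
    using \<eta> by simp
  also have "\<dots> \<le> d / (\<bar>t\<bar> + 1) * (\<bar>t\<bar> + 1)"
    by (intro mult_right_mono) (auto simp: \<eta>_def)
  finally have \<eta>t: "\<eta> * \<bar>t\<bar> < d" by simp
  define lo hi where "lo = c * t - \<eta> * \<bar>t\<bar>" and "hi = c * t + \<eta> * \<bar>t\<bar>"
  define B where "B n = {\<omega> \<in> space M. \<not> \<bar>W n \<omega> - c * T n \<omega>\<bar> \<le> \<eta> * \<bar>T n \<omega>\<bar>}" for n
  have [measurable]: "B n \<in> events" for n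
    unfolding B_def by measurable
  have lohi: "\<bar>cdf \<nu> lo - cdf \<nu> (c * t)\<bar> < e / 3" "\<bar>cdf \<nu> hi - cdf \<nu> (c * t)\<bar> < e / 3"
    by (rule d(2), use \<eta>t \<eta> in \<open>simp add: lo_def hi_def abs_mult\<close>)+
  have shifted: "lo \<le> (c - \<eta>) * t" "lo \<le> (c + \<eta>) * t" "(c - \<eta>) * t \<le> hi" "(c + \<eta>) * t \<le> hi"
    using \<eta> by (cases "t \<ge> 0"; simp add: lo_def hi_def algebra_simps mult_nonneg_nonpos)+
  \<comment> \<open>Closeness puts \<open>w\<close> between \<open>(c - \<eta>) * s\<close> and
    \<open>(c + \<eta>) * s\<close>, in an order depending on the sign of \<open>s\<close>. Both
    bounds increase with \<open>s\<close>, so they can be compared with their values at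
    \<open>t\<close>.\<close>
  have upper: "w \<le> hi" if close: "\<bar>w - c * s\<bar> \<le> \<eta> * \<bar>s\<bar>" and "s \<le> t" for w s
  proof -
    have "(c - \<eta>) * s \<le> (c - \<eta>) * t" "(c + \<eta>) * s \<le> (c + \<eta>) * t"
      using \<eta> \<open>s \<le> t\<close> by (auto intro!: mult_left_mono)
    moreover have "w \<le> (c + \<eta>) * s \<or> w \<le> (c - \<eta>) * s"
      using close by (cases "s \<ge> 0") (auto simp: algebra_simps)
    ultimately show ?thesis
      using shifted by linarith
  qed
  have lower: "s \<le> t" if close: "\<bar>w - c * s\<bar> \<le> \<eta> * \<bar>s\<bar>" and "w \<le> lo" for w s
  proof (rule ccontr)
    assume "\<not> s \<le> t"
    then have "(c - \<eta>) * t < (c - \<eta>) * s" "(c + \<eta>) * t < (c + \<eta>) * s"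
      using \<eta> by auto
    moreover have "(c - \<eta>) * s \<le> w \<or> (c + \<eta>) * s \<le> w"
      using close by (cases "s \<ge> 0") (auto simp: algebra_simps)
    ultimately show False
      using shifted \<open>w \<le> lo\<close> by linarith
  qed
  \<comment> \<open>Outside \<open>B n\<close>, \<open>T n \<le> t\<close> implies
    \<open>W n \<le> hi\<close>, and \<open>W n \<le> lo\<close> implies \<open>T n \<le> t\<close>;
    each inclusion of events costs at most \<open>prob (B n)\<close>.\<close>
  have le: "cdf (distr M borel (T n)) t \<le> cdf (distr M borel (W n)) hi + prob (B n)" for n
  proof -
    have "prob {\<omega> \<in> space M. T n \<omega> \<le> t} \<le> prob ({\<omega> \<in> space M. W n \<omega> \<le> hi} \<union> B n)"
      by (intro finite_measure_mono) (auto simp: B_def intro: upper)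
    also have "\<dots> \<le> prob {\<omega> \<in> space M. W n \<omega> \<le> hi} + prob (B n)"
      by (intro measure_Un_le) auto
    finally show ?thesis by (simp add: cdf_distr)
  qed
  have ge: "cdf (distr M borel (W n)) lo \<le> cdf (distr M borel (T n)) t + prob (B n)" for n
  proof -
    have "prob {\<omega> \<in> space M. W n \<omega> \<le> lo} \<le> prob ({\<omega> \<in> space M. T n \<omega> \<le> t} \<union> B n)"
      by (intro finite_measure_mono) (auto simp: B_def intro: lower)
    also have "\<dots> \<le> prob {\<omega> \<in> space M. T n \<omega> \<le> t} + prob (B n)"
      by (intro measure_Un_le) auto
    finally show ?thesis by (simp add: cdf_distr)
  qed
  have near: "\<forall>\<^sub>F n in sequentially. dist (cdf (distr M borel (W n)) x) (cdf \<nu> x) < e / 3" for x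
    using W cont \<open>e > 0\<close> unfolding weak_conv_m_def weak_conv_def by (intro tendstoD) auto
  \<comment> \<open>The three thirds of \<open>e\<close> pay for weak convergence at
    \<open>lo\<close> and \<open>hi\<close>, for moving the threshold back to \<open>c * t\<close>,
    and for the bad event.\<close>
  have "\<forall>\<^sub>F n in sequentially. prob (B n) < e / 3"
    using order_tendstoD(2)[OF bad[OF \<eta>(1)], of "e / 3"] \<open>e > 0\<close> by (simp add: B_def)
  with near[of lo] near[of hi]
  show "\<forall>\<^sub>F n in sequentially. dist (cdf (distr M borel (T n)) t) (cdf \<nu> (c * t)) < e"
  proof eventually_elim
    case (elim n)
    with lohi le[of n] ge[of n] show ?case
      unfolding dist_real_def by linarith
  qed
qed

section \<open>The normal limit law\<close>

lemma isCont_cdf_std_normal: "isCont (cdf std_normal_distribution) x"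
proof -
  interpret real_distribution std_normal_distribution
    by (rule real_dist_normal_dist)
  have "AE y in lborel. y \<in> {x} \<longrightarrow> ennreal (std_normal_density y) = 0"
    using AE_lborel_singleton[of x] by (rule eventually_mono) simp
  then have "{x} \<in> null_sets std_normal_distribution"
    by (subst null_sets_density_iff) (auto simp del: ennreal_eq_0_iff)
  then show ?thesis
    by (simp add: isCont_cdf measure_eq_0_null_sets)
qed

text \<open>Dividing a standard normal variable by \<open>c\<close> gives standard deviation
  \<open>1 / c\<close>. This identifies the rescaled limit in
  \<open>cdf_tendsto_of_relative_error\<close>.\<close>

lemma cdf_centered_normal:
  assumes "c > 0"
  shows "cdf (density lborel (\<lambda>x. ennreal (normal_density 0 (1 / c) x))) t
    = cdf std_normal_distribution (c * t)"
proof -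
  interpret real_distribution std_normal_distribution
    by (rule real_dist_normal_dist)
  have "distributed std_normal_distribution lborel (\<lambda>x. x) std_normal_density"
    by (simp add: distributed_def distr_id2)
  from normal_density_affine[OF this, of "1 / c" 0]
  have "distributed std_normal_distribution lborel (\<lambda>x. x / c) (normal_density 0 (1 / c))"
    using assms by simp
  then have "density lborel (\<lambda>x. ennreal (normal_density 0 (1 / c) x))
      = distr std_normal_distribution lborel (\<lambda>x. x / c)"
    by (simp add: distributed_distr_eq_density)
  also have "measure \<dots> {..t} = measure std_normal_distribution {..c * t}"
    using assms by (subst measure_distr)
      (auto intro!: arg_cong[where f = "measure std_normal_distribution"] simp: field_simps)
  finally show ?thesis
    by (simp add: cdf_def)
qed

section \<open>Asymptotic normality of the estimator\<close>

theorem theorem6p5: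
  fixes M :: "'a measure" and X :: "nat \<Rightarrow> 'a \<Rightarrow> real"
    and \<mu> \<sigma> \<alpha> :: real and \<alpha>_hat :: "nat \<Rightarrow> 'a \<Rightarrow> real"
  assumes "prob_space M"
    and "\<sigma> > 0"
    and "\<alpha> \<in> bn_alpha_space"
    and "prob_space.indep_vars M (\<lambda>_. borel) X UNIV"
    and "\<And>i. distr M borel (X i) = BN \<mu> \<sigma> \<alpha>"
    and "bn_consistent_solution M X \<mu> \<sigma> \<alpha> \<alpha>_hat"
  shows "weak_conv_m (\<lambda>n. distr M borel (\<lambda>\<omega>. sqrt (real n) * (\<alpha>_hat n \<omega> - \<alpha>)))
           (density lborel (\<lambda>x. ennreal (normal_density 0 (sqrt (1 / bn_fisher_info \<mu> \<sigma> \<alpha>)) x)))"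
proof -
  interpret prob_space M by fact
  have \<alpha>: "\<alpha> \<noteq> 0"
    using assms(3) by (simp add: bn_alpha_space_def)
  have X_meas [measurable]: "X i \<in> borel_measurable M" for i
    using assms(4) unfolding indep_vars_def2 by simp
  have hat_meas [measurable]: "\<And>n. \<alpha>_hat n \<in> borel_measurable M"
    and root: "(\<lambda>n. prob {\<omega> \<in> space M. (\<Sum>i<n. bn_score \<mu> \<sigma> (\<alpha>_hat n \<omega>) (X i \<omega>)) = 0}) \<longlonglongrightarrow> 1"
    and consistent: "\<And>\<epsilon>. \<epsilon> > 0 \<Longrightarrow> (\<lambda>n. prob {\<omega> \<in> space M. \<bar>\<alpha>_hat n \<omega> - \<alpha>\<bar> > \<epsilon>}) \<longlonglongrightarrow> 0"
    using assms(6) deriv_bn_loglik[OF \<open>\<sigma> > 0\<close>]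
    by (auto simp: bn_consistent_solution_def conv_in_prob_def)
  have integral_X: "integral\<^sup>L M (\<lambda>\<omega>. g (X i \<omega>)) = integral\<^sup>L (BN \<mu> \<sigma> \<alpha>) g"
    if "g \<in> borel_measurable borel" for g :: "real \<Rightarrow> real" and i
    using integral_distr[OF X_meas that, of i] assms(5) by simp
  have distr_X: "distr M borel (\<lambda>\<omega>. g (X i \<omega>)) = distr (BN \<mu> \<sigma> \<alpha>) borel g"
    if "g \<in> borel_measurable borel" for g :: "real \<Rightarrow> real" and i
    using distr_distr[OF that X_meas, of i] assms(5) by (simp add: comp_def)
  define J where "J = bn_fisher_info \<mu> \<sigma> \<alpha>"
  have "J > 0"
    unfolding J_def by (rule bn_fisher_info_pos[OF \<open>\<sigma> > 0\<close> \<alpha>])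
  define Y where "Y i \<omega> = bn_score \<mu> \<sigma> \<alpha> (X i \<omega>)" for i \<omega>
  define Z where "Z i \<omega> = bn_curv \<mu> \<sigma> \<alpha> (X i \<omega>)" for i \<omega>
  define H where "H n \<omega> = (\<Sum>i<n. Z i \<omega>) / real n" for n \<omega>
  \<comment> \<open>The normaliser is written in the shape of the central limit theorem for standard
    deviation \<open>sqrt J\<close>.\<close>
  define W where "W n \<omega> = (\<Sum>i<n. Y i \<omega>) / sqrt (real n * (sqrt J)\<^sup>2)" for n \<omega>
  define T where "T n \<omega> = sqrt (real n) * (\<alpha>_hat n \<omega> - \<alpha>)" for n \<omega>
  have [measurable]: "Y i \<in> borel_measurable M" "Z i \<in> borel_measurable M" for i
    unfolding Y_def Z_def by measurable
  have H_W_T [measurable]: "H n \<in> borel_measurable M" "W n \<in> borel_measurable M"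
    "T n \<in> borel_measurable M" for n
    unfolding H_def W_def T_def by measurable

  have EY: "expectation (Y i) = 0" for i
    using has_bochner_integral_integral_eq[OF has_bochner_integral_bn_score[OF \<open>\<sigma> > 0\<close>]]
    unfolding Y_def by (simp add: integral_X)
  have CLT: "weak_conv_m (\<lambda>n. distr M borel (W n)) std_normal_distribution"
    unfolding W_def
  proof (rule central_limit_theorem_zero_mean)
    show "indep_vars (\<lambda>_. borel) Y UNIV"
      unfolding Y_def by (rule indep_vars_compose2[OF assms(4)]) measurable
    show "integrable M (\<lambda>\<omega>. (Y n \<omega>)\<^sup>2)" for n
    proof -
      have "integrable (distr M borel (X n)) (\<lambda>x. (bn_score \<mu> \<sigma> \<alpha> x)\<^sup>2)"
        using bn_score_curv_integrals(1)[OF \<open>\<sigma> > 0\<close>] assms(5) by simp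
      then show ?thesis
        unfolding Y_def by (subst (asm) integrable_distr_eq) measurable
    qed
    show "variance (Y n) = (sqrt J)\<^sup>2" for n
      using \<open>J > 0\<close> integral_X[of "\<lambda>x. (bn_score \<mu> \<sigma> \<alpha> x)\<^sup>2" n]
      by (simp add: EY Y_def[symmetric] J_def bn_fisher_info_eq[OF \<open>\<sigma> > 0\<close>])
    show "distr M borel (Y n) = distr (BN \<mu> \<sigma> \<alpha>) borel (bn_score \<mu> \<sigma> \<alpha>)" for n
      unfolding Y_def by (rule distr_X) measurable
  qed (use EY \<open>J > 0\<close> in auto)

  have LLN: "(\<lambda>n. prob {\<omega> \<in> space M. \<bar>H n \<omega> - (1 - J)\<bar> \<ge> \<epsilon>}) \<longlonglongrightarrow> 0" if "\<epsilon> > 0" for \<epsilon>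
  proof -
    have "expectation (Z 0) = 1 - J"
      using bn_score_curv_integrals(2)[OF \<open>\<sigma> > 0\<close>] unfolding Z_def J_def
      by (simp add: integral_X)
    moreover have "indep_vars (\<lambda>_. borel) Z UNIV"
      unfolding Z_def by (rule indep_vars_compose2[OF assms(4)]) measurable
    moreover have "distr M borel (Z i) = distr (BN \<mu> \<sigma> \<alpha>) borel (bn_curv \<mu> \<sigma> \<alpha>)" for i
      unfolding Z_def by (rule distr_X) measurable
    moreover have "Z 0 \<omega> \<in> {0..1 / \<alpha>\<^sup>2}" for \<omega>
      using bn_curv_bounds[OF \<alpha>] by (simp add: Z_def)
    ultimately show ?thesis
      using weak_law_bounded[of Z _ 0 "1 / \<alpha>\<^sup>2" \<epsilon>] \<alpha> that by (simp add: H_def)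
  qed

  \<comment> \<open>The likelihood equation makes the score sum approximately
    \<open>n * J * (\<alpha>_hat - \<alpha>)\<close>, hence \<open>W n\<close> approximately
    \<open>sqrt J * T n\<close>. This can fail only if the equation is not solved, the estimator is
    far from \<open>\<alpha>\<close>, or the mean curvature deviates.\<close>
  have bad: "(\<lambda>n. prob {\<omega> \<in> space M. \<not> \<bar>W n \<omega> - sqrt J * T n \<omega>\<bar> \<le> \<eta> * \<bar>T n \<omega>\<bar>}) \<longlonglongrightarrow> 0"
    if "\<eta> > 0" for \<eta>
  proof -
    \<comment> \<open>\<open>\<kappa>\<close> is the Taylor constant. Two errors of relative size
      \<open>\<epsilon>\<close> add up to \<open>\<eta> * sqrt J\<close>. \<open>\<delta>\<close>
      keeps the estimator in the range of the expansion and makes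
      \<open>\<kappa> * \<bar>h\<bar> \<le> \<epsilon>\<close>.\<close>
    define \<kappa> where "\<kappa> = 8 / \<bar>\<alpha>\<bar> ^ 3"
    define \<epsilon> where "\<epsilon> = \<eta> * sqrt J / 2"
    define \<delta> where "\<delta> = min (\<bar>\<alpha>\<bar> / 2) (\<epsilon> / \<kappa>)"
    have pos: "\<kappa> > 0" "\<epsilon> > 0" "\<delta> > 0"
      using \<alpha> \<open>\<eta> > 0\<close> \<open>J > 0\<close> by (auto simp: \<kappa>_def \<epsilon>_def \<delta>_def)
    define E where "E n = {\<omega> \<in> space M. (\<Sum>i<n. bn_score \<mu> \<sigma> (\<alpha>_hat n \<omega>) (X i \<omega>)) = 0}" for n
    define A where "A n = {\<omega> \<in> space M. \<bar>\<alpha>_hat n \<omega> - \<alpha>\<bar> > \<delta>}" for n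
    define B where "B n = {\<omega> \<in> space M. \<bar>H n \<omega> - (1 - J)\<bar> \<ge> \<epsilon>}" for n
    have [measurable]: "E n \<in> events" "A n \<in> events" "B n \<in> events" for n
      unfolding E_def A_def B_def bn_score_def by measurable
    have good: "\<bar>W n \<omega> - sqrt J * T n \<omega>\<bar> \<le> \<eta> * \<bar>T n \<omega>\<bar>"
      if "n > 0" "\<omega> \<in> E n" "\<omega> \<notin> A n" "\<omega> \<notin> B n" for n \<omega>
    proof -
      define h where "h = \<alpha>_hat n \<omega> - \<alpha>"
      define S where "S = (\<Sum>i<n. Y i \<omega>)"
      have h: "\<bar>h\<bar> \<le> \<delta>" and H: "\<bar>H n \<omega> - (1 - J)\<bar> \<le> \<epsilon>"
        using that by (auto simp: A_def B_def E_def h_def)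
      have "\<kappa> * \<bar>h\<bar> \<le> \<kappa> * (\<epsilon> / \<kappa>)"
        using h pos by (intro mult_left_mono) (auto simp: \<delta>_def)
      then have \<kappa>h: "\<kappa> * \<bar>h\<bar> \<le> \<epsilon>"
        using pos by simp
      \<comment> \<open>One factor \<open>\<kappa> * \<bar>h\<bar>\<close> of the quadratic
        remainder is absorbed into \<open>\<epsilon>\<close>, so the error becomes linear in
        \<open>\<bar>h\<bar>\<close>, that is, relative to \<open>T n\<close>.\<close>
      have "\<bar>S - h * (\<Sum>i<n. 1 - Z i \<omega>)\<bar> \<le> real n * (\<kappa> * h\<^sup>2)"
        unfolding S_def h_def Y_def Z_def \<kappa>_def
        using that h by (intro bn_score_expansion \<alpha>) (auto simp: E_def \<delta>_def h_def)
      also have "h * (\<Sum>i<n. 1 - Z i \<omega>) = real n * h * (1 - H n \<omega>)"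
        using \<open>n > 0\<close> by (simp add: H_def sum_subtractf field_simps)
      also have "real n * (\<kappa> * h\<^sup>2) = real n * \<bar>h\<bar> * (\<kappa> * \<bar>h\<bar>)"
        by (subst power2_abs[of h, symmetric]) (simp only: power2_eq_square mult_ac)
      also have "\<dots> \<le> real n * \<bar>h\<bar> * \<epsilon>"
        using \<kappa>h by (intro mult_left_mono) auto
      finally have 1: "\<bar>S - real n * h * (1 - H n \<omega>)\<bar> \<le> real n * \<bar>h\<bar> * \<epsilon>" .
      have "\<bar>real n * h * (H n \<omega> - (1 - J))\<bar> = real n * \<bar>h\<bar> * \<bar>H n \<omega> - (1 - J)\<bar>"
        by (simp add: abs_mult)
      also have "\<dots> \<le> real n * \<bar>h\<bar> * \<epsilon>"
        using H by (intro mult_left_mono) auto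
      finally have 2: "\<bar>real n * h * (H n \<omega> - (1 - J))\<bar> \<le> real n * \<bar>h\<bar> * \<epsilon>" .
      \<comment> \<open>The Taylor error and the law-of-large-numbers error separate here.\<close>
      have "S - real n * h * J
          = (S - real n * h * (1 - H n \<omega>)) - real n * h * (H n \<omega> - (1 - J))"
        by (simp add: algebra_simps)
      with 1 2 have "\<bar>S - real n * h * J\<bar> \<le> real n * \<bar>h\<bar> * \<epsilon> + real n * \<bar>h\<bar> * \<epsilon>"
        by linarith
      also have "\<dots> = real n * \<bar>h\<bar> * (\<eta> * sqrt J)"
        by (simp add: \<epsilon>_def algebra_simps)
      finally have main: "\<bar>S - real n * h * J\<bar> \<le> real n * \<bar>h\<bar> * (\<eta> * sqrt J)" .
      define r j where "r = sqrt (real n)" and "j = sqrt J"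
      have rj: "r > 0" "j > 0" "real n = r * r" "J = j * j"
        using \<open>n > 0\<close> \<open>J > 0\<close> by (auto simp: r_def j_def)
      have "W n \<omega> - sqrt J * T n \<omega> = (S - real n * h * J) / (r * j)"
        unfolding W_def T_def S_def[symmetric] h_def[symmetric] j_def[symmetric] r_def[symmetric]
        using rj(1,2) by (simp add: real_sqrt_mult rj(3,4) field_simps)
      also have "\<bar>\<dots>\<bar> \<le> real n * \<bar>h\<bar> * (\<eta> * j) / (r * j)"
        using divide_right_mono[OF main[folded j_def], of "r * j"] rj(1,2)
        by (simp only: abs_divide abs_mult abs_of_pos mult_pos_pos less_imp_le)
      also have "\<dots> = \<eta> * \<bar>T n \<omega>\<bar>"
        unfolding T_def h_def[symmetric] r_def[symmetric]
        using rj(1,2) by (simp add: rj(3) abs_mult)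
      finally show ?thesis .
    qed
    have bound: "prob {\<omega> \<in> space M. \<not> \<bar>W n \<omega> - sqrt J * T n \<omega>\<bar> \<le> \<eta> * \<bar>T n \<omega>\<bar>}
        \<le> (1 - prob (E n)) + prob (A n) + prob (B n)" if "n > 0" for n
    proof -
      have "prob {\<omega> \<in> space M. \<not> \<bar>W n \<omega> - sqrt J * T n \<omega>\<bar> \<le> \<eta> * \<bar>T n \<omega>\<bar>}
          \<le> prob ((space M - E n) \<union> A n \<union> B n)"
        using good[OF that] by (intro finite_measure_mono) auto
      also have "\<dots> \<le> prob ((space M - E n) \<union> A n) + prob (B n)"
        by (intro measure_Un_le) auto
      also have "\<dots> \<le> prob (space M - E n) + prob (A n) + prob (B n)"
        by (intro add_right_mono measure_Un_le) auto
      finally show ?thesis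
        by (simp add: prob_compl)
    qed
    have "(\<lambda>n. (1 - prob (E n)) + prob (A n) + prob (B n)) \<longlonglongrightarrow> (1 - 1) + 0 + 0"
      unfolding E_def A_def B_def
      by (intro tendsto_add tendsto_diff tendsto_const root consistent LLN pos)
    then have lim: "(\<lambda>n. (1 - prob (E n)) + prob (A n) + prob (B n)) \<longlonglongrightarrow> 0"
      by simp
    show ?thesis
    proof (rule tendsto_sandwich[OF _ _ tendsto_const lim])
      show "\<forall>\<^sub>F n in sequentially.
          prob {\<omega> \<in> space M. \<not> \<bar>W n \<omega> - sqrt J * T n \<omega>\<bar> \<le> \<eta> * \<bar>T n \<omega>\<bar>}
          \<le> (1 - prob (E n)) + prob (A n) + prob (B n)"
        using eventually_gt_at_top[of 0] by (rule eventually_mono) (rule bound)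
    qed (intro always_eventually allI measure_nonneg)
  qed

  \<comment> \<open>The Slutsky-type lemma is used with \<open>c = sqrt J\<close>; the factor in the
    threshold becomes the standard deviation \<open>1 / sqrt J\<close> of the limit.\<close>
  have "(\<lambda>n. cdf (distr M borel (T n)) t) \<longlonglongrightarrow> cdf std_normal_distribution (sqrt J * t)" for t
  proof (rule cdf_tendsto_of_relative_error)
    show "sqrt J > 0"
      using \<open>J > 0\<close> by simp
  qed (rule H_W_T CLT isCont_cdf_std_normal bad, assumption?)+
  then have "weak_conv_m (\<lambda>n. distr M borel (T n))
      (density lborel (\<lambda>x. ennreal (normal_density 0 (1 / sqrt J) x)))"
    using \<open>J > 0\<close> by (simp add: weak_conv_m_def weak_conv_def cdf_centered_normal)
  then show ?thesis
    by (simp add: T_def[abs_def] J_def real_sqrt_divide)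
qed

end
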